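(* Let $G$ be a finite simple graph with at least one edge. Then $$\widetilde{\alpha_0}(G)=\frac{1}{\vartheta(\overline{G})}.$$
   Context: Let $G$ be a simple graph on $n$ vertices with adjacency matrix $A$, and let $\overline{G}$ be its complement. $\mathbb{S}_n$ is the set of real symmetric $n\times n$ matrices, $J$ the all-ones matrix, $I$ the identity, $\circ$ the entrywise product, $\langle M,N\rangle=\operatorname{tr}(M^TN)$, and $M\succcurlyeq 0$ means $M$ is positive semidefinite. The parameter $\widetilde{\alpha_0}=\widetilde{\alpha_0}(G)$ is defined as the minimum of $\alpha$ over all triples $(\alpha,Y,Z)$ with $\alpha\in\mathbb{R}$, $Y,Z\in\mathbb{S}_n$ satisfying $$\alpha Y+(1-\alpha)Z\succcurlyeq 0,\quad Y\circ I=Y,\quad Z\circ A=Z,\quad \langle J,Y\rangle=1,\quad \langle J,Y-Z\rangle=0.$$ (So $Y$ is diagonal, and $Z$ is supported on the entries corresponding to edges of $G$.) The Lovász theta number of a graph $H$ on $n$ vertices is $$\vartheta(H)=\max\{\langle X,J\rangle:\ X\in\mathbb{S}_n,\ X\circ A(H)=0,\ \langle X,I\rangle=1,\ X\succcurlyeq 0\},$$ where $A(H)$ is the adjacency matrix of $H$. *)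

theory Defs
  imports "HOL-Analysis.Analysis"
begin

(* The vertex set of a graph is the finite type 'n, and E is its adjacency relation. *)

definition simple_graph :: "('n \<Rightarrow> 'n \<Rightarrow> bool) \<Rightarrow> bool" where
  "simple_graph E \<longleftrightarrow> symp E \<and> irreflp E"

definition complement_graph :: "('n \<Rightarrow> 'n \<Rightarrow> bool) \<Rightarrow> 'n \<Rightarrow> 'n \<Rightarrow> bool" where
  "complement_graph E = (\<lambda>i j. i \<noteq> j \<and> \<not> E i j)"

definition adjacency_matrix :: "('n::finite \<Rightarrow> 'n \<Rightarrow> bool) \<Rightarrow> real^'n^'n" where
  "adjacency_matrix E = (\<chi> i j. if E i j then 1 else 0)"

definition all_ones :: "real^'n^'n" where
  "all_ones = (\<chi> i j. 1)"

definition symmetric_matrix :: "real^'n^'n \<Rightarrow> bool" where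
  "symmetric_matrix M \<longleftrightarrow> transpose M = M"

definition psd :: "real^'n^'n \<Rightarrow> bool" where
  "psd M \<longleftrightarrow> symmetric_matrix M \<and> (\<forall>x. 0 \<le> x \<bullet> (M *v x))"

definition trace_inner :: "real^'n^'n \<Rightarrow> real^'n^'n \<Rightarrow> real" where
  "trace_inner M N = trace (transpose M ** N)"

(* The library's infix product "M * N" on real^'n^'n is entrywise (Hadamard), as opposed to
   the matrix product "M ** N". *)

definition alpha0_feasible ::
  "('n::finite \<Rightarrow> 'n \<Rightarrow> bool) \<Rightarrow> real \<Rightarrow> real^'n^'n \<Rightarrow> real^'n^'n \<Rightarrow> bool" where
  "alpha0_feasible E \<alpha> Y Z \<longleftrightarrow>
     symmetric_matrix Y \<and> symmetric_matrix Z \<and>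
     psd (\<alpha> *\<^sub>R Y + (1 - \<alpha>) *\<^sub>R Z) \<and>
     Y * mat 1 = Y \<and>
     Z * adjacency_matrix E = Z \<and>
     trace_inner all_ones Y = 1 \<and>
     trace_inner all_ones (Y - Z) = 0"

(* LEAST and GREATEST over the reals denote an attained minimum and maximum; unlike Inf and
   Sup they have no specified value when the extremum is not attained. *)

definition alpha0_tilde :: "('n::finite \<Rightarrow> 'n \<Rightarrow> bool) \<Rightarrow> real" where
  "alpha0_tilde E = (LEAST \<alpha>. \<exists>Y Z. alpha0_feasible E \<alpha> Y Z)"

definition theta_feasible :: "('n::finite \<Rightarrow> 'n \<Rightarrow> bool) \<Rightarrow> real^'n^'n \<Rightarrow> bool" where
  "theta_feasible H X \<longleftrightarrow>
     symmetric_matrix X \<and>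
     X * adjacency_matrix H = 0 \<and>
     trace_inner X (mat 1) = 1 \<and>
     psd X"

definition lovasz_theta :: "('n::finite \<Rightarrow> 'n \<Rightarrow> bool) \<Rightarrow> real" where
  "lovasz_theta H = (GREATEST t. \<exists>X. theta_feasible H X \<and> t = trace_inner X all_ones)"

end

theory Submission
  imports Defs
begin

text \<open>
  If \<open>(\<alpha>, Y, Z)\<close> is feasible, then \<open>M = \<alpha> Y + (1 - \<alpha>) Z\<close> is positive semidefinite, is supported
  on the diagonal and the edges, has trace \<open>\<alpha>\<close> and entry sum 1. Hence \<open>\<alpha> > 0\<close>, and \<open>M / \<alpha>\<close> is
  feasible for \<open>\<vartheta>\<close> of the complement with objective value \<open>1 / \<alpha>\<close>. Conversely, an \<open>X\<close> that is
  feasible for \<open>\<vartheta>\<close> with value \<open>t\<close> splits, after division by \<open>t\<close>, into its diagonal and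
  off-diagonal parts; rescaling these to entry sum 1 requires \<open>1 / t \<noteq> 1\<close>. A single edge yields
  \<open>t = 2\<close>, so this holds at the maximum, which exists by compactness.
\<close>

lemma trace_inner_eq_inner: "trace_inner M N = M \<bullet> N"
proof -
  have "trace_inner M N = (\<Sum>j\<in>UNIV. \<Sum>i\<in>UNIV. M $ i $ j * N $ i $ j)"
    by (simp add: trace_inner_def trace_def matrix_matrix_mult_def transpose_def)
  also have "\<dots> = M \<bullet> N"
    by (subst sum.swap) (simp add: inner_vec_def)
  finally show ?thesis .
qed

lemma inner_mat_1: "M \<bullet> mat 1 = trace (M :: real^'n^'n)"
  by (simp add: inner_vec_def mat_def trace_def if_distrib cong: if_cong)

lemma inner_all_ones: "all_ones \<bullet> M = (\<Sum>i\<in>UNIV. \<Sum>j\<in>UNIV. M $ i $ j)"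
  by (simp add: inner_vec_def all_ones_def)

lemma symmetric_matrix_iff: "symmetric_matrix M \<longleftrightarrow> (\<forall>i j. M $ i $ j = M $ j $ i)"
  by (auto simp: symmetric_matrix_def transpose_def vec_eq_iff)

lemma symmetric_matrix_scaleR: "symmetric_matrix M \<Longrightarrow> symmetric_matrix (c *\<^sub>R M)"
  by (simp add: symmetric_matrix_iff)

lemma quadratic_form_eq_sum:
  "x \<bullet> (M *v x) = (\<Sum>i\<in>UNIV. \<Sum>j\<in>UNIV. x $ i * M $ i $ j * x $ j)" for M :: "real^'n^'n"
  by (simp add: inner_vec_def matrix_vector_mult_def sum_distrib_left mult.assoc)

lemma psd_scaleR: "psd M \<Longrightarrow> 0 \<le> c \<Longrightarrow> psd (c *\<^sub>R M)"
  by (simp add: psd_def symmetric_matrix_scaleR scaleR_matrix_vector_assoc[symmetric])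

lemma psd_diag_nonneg:
  assumes "psd M"
  shows "0 \<le> M $ i $ i"
proof -
  have "0 \<le> axis i 1 \<bullet> (M *v axis i 1)"
    using assms by (simp add: psd_def)
  then show ?thesis
    by (simp add: matrix_vector_mult_basis inner_axis' column_def)
qed

text \<open>Testing the quadratic form on the sum and the difference of two basis vectors gives 2
  |M_ij| \<le> M_ii + M_jj, and each diagonal entry is at most the trace because all of them are
  nonnegative. This bounds the feasible set of theta and forces a nonzero \<open>psd\<close> matrix
  to have positive trace.\<close>

lemma psd_abs_entry_le_trace:
  assumes "psd M"
  shows "\<bar>M $ i $ j\<bar> \<le> trace M"
proof -
  have diag_le: "M $ k $ k \<le> trace M" for k
    unfolding trace_def by (rule member_le_sum) (auto intro: psd_diag_nonneg assms)
  have quad: "0 \<le> (axis i 1 + s *\<^sub>R axis j 1) \<bullet> (M *v (axis i 1 + s *\<^sub>R axis j 1))" for s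
    using assms by (simp add: psd_def)
  have sym: "M $ j $ i = M $ i $ j"
    using assms by (simp add: psd_def symmetric_matrix_iff)
  have "0 \<le> M $ i $ i + 2 * s * M $ i $ j + s * s * M $ j $ j" for s
    using quad[of s] sym
    by (simp add: matrix_vector_right_distrib matrix_vector_mult_scaleR
        matrix_vector_mult_basis inner_axis' column_def inner_add_left algebra_simps)
  from this[of 1] this[of "-1"] diag_le[of i] diag_le[of j] show ?thesis
    by simp
qed

lemma psd_trace_pos:
  assumes "psd M" "M \<noteq> 0"
  shows "0 < trace M"
proof -
  obtain i j where "M $ i $ j \<noteq> 0"
    using assms(2) by (auto simp: vec_eq_iff)
  with psd_abs_entry_le_trace[OF assms(1), of i j] show ?thesis
    by linarith
qed

lemma hadamard_adjacency_eq_0_iff: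
  "X * adjacency_matrix H = 0 \<longleftrightarrow> (\<forall>i j. H i j \<longrightarrow> X $ i $ j = 0)"
  by (auto simp: vec_eq_iff adjacency_matrix_def)

lemma hadamard_adjacency_eq_self_iff:
  "Z * adjacency_matrix E = Z \<longleftrightarrow> (\<forall>i j. \<not> E i j \<longrightarrow> Z $ i $ j = 0)"
  by (auto simp: vec_eq_iff adjacency_matrix_def)

lemma hadamard_mat_1_eq_self_iff:
  "Y * mat 1 = Y \<longleftrightarrow> (\<forall>i j. i \<noteq> j \<longrightarrow> Y $ i $ j = 0)" for Y :: "real^'n^'n"
  by (auto simp: vec_eq_iff mat_def)

lemma theta_feasible_iff:
  "theta_feasible H X \<longleftrightarrow> psd X \<and> trace X = 1 \<and> (\<forall>i j. H i j \<longrightarrow> X $ i $ j = 0)"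
  by (auto simp: theta_feasible_def psd_def trace_inner_eq_inner inner_mat_1
      hadamard_adjacency_eq_0_iff)

lemma compact_theta_feasible:
  fixes H :: "'n::finite \<Rightarrow> 'n \<Rightarrow> bool"
  shows "compact {X. theta_feasible H X}"
proof -
  have "closed {X. theta_feasible H X}"
    \<comment> \<open>Written out in entries, each condition is an equation or a weak inequality
      between continuous functions of X. The premise \<open>H i j\<close> does not depend on X, so
      the implication is closed as well.\<close>
    unfolding theta_feasible_iff psd_def symmetric_matrix_iff quadratic_form_eq_sum trace_def
    by (intro closed_Collect_conj closed_Collect_all closed_Collect_imp open_Collect_const
        closed_Collect_eq closed_Collect_le continuous_intros)
  moreover have "bounded {X. theta_feasible H X}"
  proof (rule boundedI)
    fix X :: "real^'n^'n"
    assume "X \<in> {X. theta_feasible H X}"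
    then have entry: "\<bar>X $ i $ j\<bar> \<le> 1" for i j
      using psd_abs_entry_le_trace[of X i j] by (simp add: theta_feasible_iff)
    have "norm X \<le> (\<Sum>i\<in>UNIV. norm (X $ i))"
      by (simp add: norm_vec_def L2_set_le_sum)
    also have "\<dots> \<le> (\<Sum>i\<in>(UNIV::'n set). \<Sum>j\<in>(UNIV::'n set). 1)"
    proof (rule sum_mono)
      fix i
      have "norm (X $ i) \<le> (\<Sum>j\<in>UNIV. \<bar>X $ i $ j\<bar>)"
        by (rule norm_le_l1_cart)
      also have "\<dots> \<le> (\<Sum>j\<in>(UNIV::'n set). 1)"
        by (rule sum_mono) (rule entry)
      finally show "norm (X $ i) \<le> (\<Sum>j\<in>(UNIV::'n set). 1)" .
    qed
    finally show "norm X \<le> (\<Sum>i\<in>(UNIV::'n set). \<Sum>j\<in>(UNIV::'n set). 1)" .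
  qed
  ultimately show ?thesis
    by (simp add: compact_eq_bounded_closed)
qed

text \<open>\<open>GREATEST\<close> carries information only if a maximum exists. Compactness
  provides one as soon as the feasible set is nonempty, which is what \<open>X\<^sub>0\<close>
  witnesses.\<close>

lemma lovasz_theta_attained:
  assumes "theta_feasible H X\<^sub>0"
  obtains X where "theta_feasible H X" "all_ones \<bullet> X = lovasz_theta H"
    "\<And>X'. theta_feasible H X' \<Longrightarrow> all_ones \<bullet> X' \<le> lovasz_theta H"
proof -
  have "continuous_on {X. theta_feasible H X} (\<lambda>X. all_ones \<bullet> X)"
    by (intro continuous_intros)
  then obtain X where X: "theta_feasible H X"
    and max: "\<And>X'. theta_feasible H X' \<Longrightarrow> all_ones \<bullet> X' \<le> all_ones \<bullet> X"
    using continuous_attains_sup[OF compact_theta_feasible, of H "\<lambda>X. all_ones \<bullet> X"] assms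
    by blast
  have "lovasz_theta H = all_ones \<bullet> X"
    unfolding lovasz_theta_def
    by (rule Greatest_equality) (use X max in \<open>auto simp: trace_inner_eq_inner inner_commute\<close>)
  with X max show thesis
    by (intro that[of X]) auto
qed

text \<open>The witness is u u^T / 2 for the indicator vector u of the two ends of the edge. Its
  value 2 shows both that the feasible set is nonempty and that the maximum exceeds 1.\<close>

lemma theta_feasible_edge:
  fixes E :: "'n::finite \<Rightarrow> 'n \<Rightarrow> bool"
  assumes "simple_graph E" "E a b"
  obtains X where "theta_feasible (complement_graph E) X" "all_ones \<bullet> X = 2"
proof
  define u :: "real^'n" where "u = (\<chi> i. of_bool (i = a) + of_bool (i = b))"
  define X :: "real^'n^'n" where "X = (\<chi> i j. u $ i * u $ j / 2)"
  have ab: "a \<noteq> b" "E b a"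
    using assms by (auto simp: simple_graph_def irreflp_def dest: sympD)
  have u_sum: "(\<Sum>i\<in>UNIV. u $ i) = 2"
    by (simp add: u_def sum.distrib of_bool_def)
  \<comment> \<open>Since a and b differ, u takes only the values 0 and 1, so the trace of X is half
    the entry sum of u.\<close>
  have u_sq: "u $ i * u $ i = u $ i" for i
    using ab by (simp add: u_def of_bool_def)
  have "0 \<le> x \<bullet> (X *v x)" for x
  proof -
    have "x \<bullet> (X *v x) = (\<Sum>i\<in>UNIV. \<Sum>j\<in>UNIV. (x $ i * u $ i) * (x $ j * u $ j)) / 2"
      unfolding quadratic_form_eq_sum sum_divide_distrib X_def by (simp add: mult_ac)
    also have "\<dots> = (x \<bullet> u)\<^sup>2 / 2"
      by (simp add: sum_product power2_eq_square inner_vec_def)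
    also have "\<dots> \<ge> 0"
      by simp
    finally show ?thesis .
  qed
  moreover have "symmetric_matrix X"
    by (simp add: symmetric_matrix_iff X_def)
  ultimately have "psd X"
    by (simp add: psd_def)
  moreover have "trace X = 1"
    using u_sum by (simp add: trace_def X_def u_sq sum_divide_distrib[symmetric])
  \<comment> \<open>Off the diagonal, X is nonzero only at (a, b) and (b, a), and both are edges of
    \<open>E\<close>.\<close>
  moreover have "X $ i $ j = 0" if "complement_graph E i j" for i j
    using that assms ab by (auto simp: X_def u_def complement_graph_def)
  ultimately show "theta_feasible (complement_graph E) X"
    by (simp add: theta_feasible_iff)
  have "all_ones \<bullet> X = (\<Sum>i\<in>UNIV. u $ i) * (\<Sum>j\<in>UNIV. u $ j) / 2"
    unfolding inner_all_ones sum_product sum_divide_distrib by (simp add: X_def)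
  then show "all_ones \<bullet> X = 2"
    by (simp add: u_sum)
qed

lemma alpha0_feasible_imp_theta_feasible:
  assumes "simple_graph E" "alpha0_feasible E \<alpha> Y Z"
  obtains X where "0 < \<alpha>" "theta_feasible (complement_graph E) X" "all_ones \<bullet> X = 1 / \<alpha>"
proof -
  define M where "M = \<alpha> *\<^sub>R Y + (1 - \<alpha>) *\<^sub>R Z"
  have psd: "psd M" and Y: "\<And>i j. i \<noteq> j \<Longrightarrow> Y $ i $ j = 0"
    and Z: "\<And>i j. \<not> E i j \<Longrightarrow> Z $ i $ j = 0"
    and Y_sum: "all_ones \<bullet> Y = 1" and Z_sum: "all_ones \<bullet> Z = 1"
    using assms(2)
    by (auto simp: alpha0_feasible_def M_def trace_inner_eq_inner inner_diff_right
        hadamard_mat_1_eq_self_iff hadamard_adjacency_eq_self_iff)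
  have irrefl: "\<not> E i i" for i
    using assms(1) by (simp add: simple_graph_def irreflp_def)
  \<comment> \<open>For the diagonal Y the entry sum is the trace, so Y has trace 1. Z has zero
    diagonal, so only Y contributes to the trace of M.\<close>
  have "(\<Sum>j\<in>UNIV. Y $ i $ j) = Y $ i $ i" for i
    by (rule trans[OF sum.mono_neutral_right[of UNIV "{i}"]]) (auto simp: Y)
  then have "trace Y = 1"
    using Y_sum by (simp add: inner_all_ones trace_def)
  moreover have "trace Z = 0"
    by (simp add: trace_def Z irrefl)
  ultimately have trace_M: "trace M = \<alpha>"
    by (simp add: inner_mat_1[symmetric] M_def inner_add_left)
  have sum_M: "all_ones \<bullet> M = 1"
    by (simp add: M_def inner_add_right Y_sum Z_sum)
  \<comment> \<open>The zero matrix has entry sum 0, not 1. Being nonzero, M has positive trace, and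
    that trace is \<alpha>.\<close>
  then have "M \<noteq> 0"
    by auto
  then have pos: "0 < \<alpha>"
    using psd_trace_pos[OF psd] trace_M by simp
  moreover have "theta_feasible (complement_graph E) ((1 / \<alpha>) *\<^sub>R M)"
  proof -
    have "trace ((1 / \<alpha>) *\<^sub>R M) = 1"
      using trace_M pos by (simp add: inner_mat_1[symmetric])
    moreover have "M $ i $ j = 0" if "complement_graph E i j" for i j
      using that by (simp add: complement_graph_def M_def Y Z)
    ultimately show ?thesis
      using psd pos by (simp add: theta_feasible_iff psd_scaleR)
  qed
  ultimately show thesis
    using sum_M by (intro that[of "(1 / \<alpha>) *\<^sub>R M"]) auto
qed

lemma theta_feasible_imp_alpha0_feasible:
  fixes E :: "'n::finite \<Rightarrow> 'n \<Rightarrow> bool"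
  assumes "theta_feasible (complement_graph E) X" "1 < all_ones \<bullet> X"
  obtains Y Z where "alpha0_feasible E (1 / (all_ones \<bullet> X)) Y Z"
proof
  define t where "t = all_ones \<bullet> X"
  define D :: "real^'n^'n" where "D = (\<chi> i j. if i = j then X $ i $ j else 0)"
  \<comment> \<open>D has entry sum trace X = 1, so X - D has entry sum t - 1, and the factor
    normalises it to 1. The weight 1 - 1 / t = (t - 1) / t then cancels this factor, so the
    combination is X / t.\<close>
  let ?Z = "(1 / (t - 1)) *\<^sub>R (X - D)"
  have t: "1 < t"
    using assms(2) by (simp add: t_def)
  have X: "psd X" "trace X = 1" "\<And>i j. i \<noteq> j \<Longrightarrow> \<not> E i j \<Longrightarrow> X $ i $ j = 0"
    using assms(1) by (auto simp: theta_feasible_iff complement_graph_def)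
  have sym: "X $ i $ j = X $ j $ i" for i j
    using X(1) by (simp add: psd_def symmetric_matrix_iff)
  have D_sum: "all_ones \<bullet> D = 1"
    using X(2) by (simp add: inner_all_ones D_def trace_def)
  have "(1 / t) *\<^sub>R D + (1 - 1 / t) *\<^sub>R ?Z = (1 / t) *\<^sub>R X"
  proof -
    have "(1 - 1 / t) * (1 / (t - 1)) = 1 / t"
      using t by (simp add: field_simps)
    then show ?thesis
      by (simp add: scaleR_diff_right)
  qed
  then have "psd ((1 / t) *\<^sub>R D + (1 - 1 / t) *\<^sub>R ?Z)"
    using X(1) t by (simp add: psd_scaleR)
  moreover have "symmetric_matrix D" "symmetric_matrix ?Z"
    using sym by (auto simp: symmetric_matrix_iff D_def)
  moreover have "D * mat 1 = D"
    by (simp add: hadamard_mat_1_eq_self_iff D_def)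
  moreover have "?Z * adjacency_matrix E = ?Z"
    using X(3) by (auto simp: hadamard_adjacency_eq_self_iff D_def)
  moreover have "all_ones \<bullet> (D - ?Z) = 0"
    using t D_sum by (simp add: inner_diff_right t_def[symmetric])
  ultimately show "alpha0_feasible E (1 / (all_ones \<bullet> X)) D ?Z"
    using D_sum by (simp add: alpha0_feasible_def trace_inner_eq_inner t_def)
qed

theorem theorem4:
  fixes E :: "'n::finite \<Rightarrow> 'n \<Rightarrow> bool"
  assumes "simple_graph E"
    and "\<exists>i j. E i j"
  shows "alpha0_tilde E = 1 / lovasz_theta (complement_graph E)"
proof -
  let ?H = "complement_graph E"
  obtain X\<^sub>0 where X\<^sub>0: "theta_feasible ?H X\<^sub>0" "all_ones \<bullet> X\<^sub>0 = 2"
    using assms theta_feasible_edge by metis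
  obtain X where X: "theta_feasible ?H X" "all_ones \<bullet> X = lovasz_theta ?H"
    and max: "\<And>X'. theta_feasible ?H X' \<Longrightarrow> all_ones \<bullet> X' \<le> lovasz_theta ?H"
    using lovasz_theta_attained[OF X\<^sub>0(1)] by metis
  \<comment> \<open>Used twice: to split the maximiser into Y and Z, and, as positivity, to pass
    from 1 / \<alpha> \<le> theta to 1 / theta \<le> \<alpha>.\<close>
  have theta: "1 < lovasz_theta ?H"
    using max[OF X\<^sub>0(1)] X\<^sub>0(2) by simp
  show ?thesis
    unfolding alpha0_tilde_def
  proof (rule Least_equality)
    show "\<exists>Y Z. alpha0_feasible E (1 / lovasz_theta ?H) Y Z"
      using theta_feasible_imp_alpha0_feasible[OF X(1)] X(2) theta by metis
  next
    fix \<alpha>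
    assume "\<exists>Y Z. alpha0_feasible E \<alpha> Y Z"
    then obtain X' where "0 < \<alpha>" "theta_feasible ?H X'" "all_ones \<bullet> X' = 1 / \<alpha>"
      using alpha0_feasible_imp_theta_feasible[OF assms(1)] by metis
    with max[of X'] theta show "1 / lovasz_theta ?H \<le> \<alpha>"
      by (simp add: field_simps)
  qed
qed

end
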